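(* Let $F=(V,E)$ be any graph topology with $n$ vertices and $m$ edges whose minimum cut is at least $5\log_2(n)$. Then for any $0<\epsilon\le 1$ and $0\le\delta\le\frac{0.01\,\epsilon}{m}$ there is no $(\epsilon,\delta)$-differentially private (under the $\ell_1$ neighboring relation on weights) randomized algorithm that, for every weight vector $\mathbf{w}$ on $E$, outputs a spanning tree $T$ of $F$ with expected additive error $\mathbb{E}[w(T)]-w(T^* )\le \frac{1}{10\,\epsilon}\,n$, where $T^*$ is a minimum-weight spanning tree of $F$ with respect to $\mathbf{w}$.
   Context: Graphs are finite, simple, undirected and connected, with $m>n$; the topology $F=(V,E)$ is public and only the edge weights $\mathbf{w}\in\mathbb{R}^E$ are private. For $S\subseteq E$, $w(S)=\sum_{e\in S}w(e)$. The minimum cut of $F$ is the minimum, over partitions $V=A\sqcup B$ into two nonempty parts, of the number of edges between $A$ and $B$. Two weight vectors $\mathbf{w},\mathbf{w}'$ on $E$ are neighboring if $\|\mathbf{w}-\mathbf{w}'\|_1\le 1$. A randomized algorithm $\mathcal{A}$ is $(\epsilon,\delta)$-differentially private if for all neighboring $\mathbf{w},\mathbf{w}'$ and all sets $Y$ of outputs, $\Pr[\mathcal{A}(F,\mathbf{w})\in Y]\le e^{\epsilon}\Pr[\mathcal{A}(F,\mathbf{w}')\in Y]+\delta$. *)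

theory Defs
  imports "HOL-Probability.Probability"
begin

definition simple_graph :: "'a set \<Rightarrow> 'a set set \<Rightarrow> bool" where
  "simple_graph V E \<longleftrightarrow> finite V \<and> (\<forall>e\<in>E. e \<subseteq> V \<and> card e = 2)"

definition connected_graph :: "'a set \<Rightarrow> 'a set set \<Rightarrow> bool" where
  "connected_graph V E \<longleftrightarrow> V \<noteq> {} \<and> (\<forall>u\<in>V. \<forall>v\<in>V. (u, v) \<in> {(x, y). {x, y} \<in> E}\<^sup>*)"

text \<open>A cycle is listed by its vertices; the last vertex is joined back to the first.\<close>

definition is_cycle :: "'a set set \<Rightarrow> 'a list \<Rightarrow> bool" where
  "is_cycle E p \<longleftrightarrow> 3 \<le> length p \<and> distinct p \<and>
     (\<forall>i<length p. {p ! i, p ! (Suc i mod length p)} \<in> E)"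

definition is_tree :: "'a set \<Rightarrow> 'a set set \<Rightarrow> bool" where
  "is_tree V T \<longleftrightarrow> simple_graph V T \<and> connected_graph V T \<and> (\<nexists>p. is_cycle T p)"

definition spanning_tree :: "'a set \<Rightarrow> 'a set set \<Rightarrow> 'a set set \<Rightarrow> bool" where
  "spanning_tree V E T \<longleftrightarrow> T \<subseteq> E \<and> is_tree V T"

definition edges_between :: "'a set set \<Rightarrow> 'a set \<Rightarrow> 'a set \<Rightarrow> 'a set set" where
  "edges_between E A B = {e \<in> E. \<exists>a\<in>A. \<exists>b\<in>B. e = {a, b}}"

text \<open>Only meaningful for finite graphs with at least two vertices: otherwise there is no
  partition into two nonempty parts and \<^const>\<open>Min\<close> is applied to the empty set.\<close>

definition min_cut :: "'a set \<Rightarrow> 'a set set \<Rightarrow> nat" where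
  "min_cut V E = Min {card (edges_between E A B) | A B.
     A \<union> B = V \<and> A \<inter> B = {} \<and> A \<noteq> {} \<and> B \<noteq> {}}"

text \<open>Vectors in $R^E$ are the functions that are \<^const>\<open>undefined\<close> outside $E$, so that an
  algorithm can depend only on the weights of the edges.\<close>

abbreviation weight_vectors :: "'a set set \<Rightarrow> ('a set \<Rightarrow> real) set" where
  "weight_vectors E \<equiv> E \<rightarrow>\<^sub>E (UNIV :: real set)"

definition min_spanning_tree :: "'a set \<Rightarrow> 'a set set \<Rightarrow> ('a set \<Rightarrow> real) \<Rightarrow> 'a set set \<Rightarrow> bool" where
  "min_spanning_tree V E w T \<longleftrightarrow> spanning_tree V E T \<and>
     (\<forall>T'. spanning_tree V E T' \<longrightarrow> sum w T \<le> sum w T')"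

definition neighboring :: "'a set set \<Rightarrow> ('a set \<Rightarrow> real) \<Rightarrow> ('a set \<Rightarrow> real) \<Rightarrow> bool" where
  "neighboring E w w' \<longleftrightarrow> (\<Sum>e\<in>E. \<bar>w e - w' e\<bar>) \<le> 1"

text \<open>For a fixed public topology, a randomized algorithm is a map from weight vectors to
  distributions on outputs. The outputs here are edge sets of a finite graph, so the type
  of probability mass functions loses no generality, and every set of outputs is an event.\<close>

definition differentially_private ::
    "'a set set \<Rightarrow> real \<Rightarrow> real \<Rightarrow> (('a set \<Rightarrow> real) \<Rightarrow> 'b pmf) \<Rightarrow> bool" where
  "differentially_private E \<epsilon> \<delta> \<A> \<longleftrightarrow>
     (\<forall>w\<in>weight_vectors E. \<forall>w'\<in>weight_vectors E. neighboring E w w' \<longrightarrow>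
       (\<forall>Y. measure_pmf.prob (\<A> w) Y \<le> exp \<epsilon> * measure_pmf.prob (\<A> w') Y + \<delta>))"

end

theory Submission
  imports Defs
begin

text \<open>
  Let $L = \lfloor 1/\epsilon \rfloor$ and $x = \epsilon L \in [1/2, 1]$. For $Z \subseteq E$ let
  $w_Z$ be $0$ on $Z$ and $L$ elsewhere, and average over a uniformly random $Z$. Privacy along $L$
  unit steps bounds $\Pr[e \in T]$ for $e \in Z$ by $e^x$ times the value for $Z - \{e\}$, up to a
  negligible additive term. Since $T$ has at least $n - 1$ edges, at least about $(n - 1)/(1 + e^x)$
  of them have weight $L$ on average. On the other hand the minimum spanning tree has at most
  $c(Z) - 1$ such edges, $c(Z)$ being the number of components of $(V, Z)$, and
  $c(Z) = \sum_v 1/|C(v)| \le \sum_v 1/(1 + \deg_Z v)$ for $C(v)$ the component of $v$, which has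
  expectation at most $2n/(d + 1)$ when all degrees in $E$ are at least $d$. The cut condition only
  serves to give $d \ge 20$, and then the error $n/(10\epsilon)$ is too small.
\<close>

section \<open>Connected components\<close>

text \<open>The closure is taken on the whole type and is reflexive, so an isolated vertex forms a
  component of its own.\<close>

definition reach :: "'a set set \<Rightarrow> ('a \<times> 'a) set" where
  "reach Z = {(x, y). {x, y} \<in> Z}\<^sup>*"

definition component :: "'a set set \<Rightarrow> 'a \<Rightarrow> 'a set" where
  "component Z v = reach Z `` {v}"

definition graph_components :: "'a set \<Rightarrow> 'a set set \<Rightarrow> 'a set set" where
  "graph_components V Z = component Z ` V"

lemma connected_graph_iff_reach:
  "connected_graph V Z \<longleftrightarrow> V \<noteq> {} \<and> V \<times> V \<subseteq> reach Z"
  by (auto simp: connected_graph_def reach_def)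

lemma reach_refl [simp]: "(x, x) \<in> reach Z"
  by (simp add: reach_def)

lemma reach_edge: "{x, y} \<in> Z \<Longrightarrow> (x, y) \<in> reach Z"
  by (auto simp: reach_def)

lemma reach_trans: "(x, y) \<in> reach Z \<Longrightarrow> (y, z) \<in> reach Z \<Longrightarrow> (x, z) \<in> reach Z"
  by (auto simp: reach_def)

lemma reach_sym: "(x, y) \<in> reach Z \<Longrightarrow> (y, x) \<in> reach Z"
proof -
  have "sym {(x, y). {x, y} \<in> Z}"
    by (auto simp: sym_def insert_commute)
  then show "(x, y) \<in> reach Z \<Longrightarrow> (y, x) \<in> reach Z"
    unfolding reach_def by (metis sym_rtrancl symD)
qed

text \<open>A reflexive transitive closure is idempotent, so containment need only be checked on
  single edges.\<close>

lemma reach_subset: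
  assumes "\<And>x y. {x, y} \<in> Z \<Longrightarrow> (x, y) \<in> reach Z'"
  shows "reach Z \<subseteq> reach Z'"
proof -
  have "{(x, y). {x, y} \<in> Z}\<^sup>* \<subseteq> ({(x, y). {x, y} \<in> Z'}\<^sup>*)\<^sup>*"
    using assms by (intro rtrancl_mono) (auto simp: reach_def)
  then show ?thesis by (simp add: reach_def)
qed

lemma reach_mono: "Z \<subseteq> Z' \<Longrightarrow> reach Z \<subseteq> reach Z'"
  by (intro reach_subset reach_edge) auto

text \<open>A walk that uses the new edge repeatedly can be shortcut to use it at most once, in one
  of its two directions.\<close>

lemma reach_insert:
  "(x, y) \<in> reach (insert {a, b} Z) \<longleftrightarrow>
    (x, y) \<in> reach Z \<or> (x, a) \<in> reach Z \<and> (b, y) \<in> reach Z \<or>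
    (x, b) \<in> reach Z \<and> (a, y) \<in> reach Z"
  (is "_ \<longleftrightarrow> ?R x y")
proof
  assume "(x, y) \<in> reach (insert {a, b} Z)"
  then show "?R x y"
    unfolding reach_def[of "insert _ _"]
  proof (induction rule: rtrancl_induct)
    case (step y z)
    then consider "{y, z} \<in> Z" | "y = a" "z = b" | "y = b" "z = a"
      by (auto simp: doubleton_eq_iff)
    then show ?case
    proof cases
      case 1
      with step.IH show ?thesis by (meson reach_edge reach_trans)
    next
      case 2
      with step.IH show ?thesis by auto
    next
      case 3
      with step.IH show ?thesis by auto
    qed
  qed simp
next
  have "reach Z \<subseteq> reach (insert {a, b} Z)" by (rule reach_mono) auto
  moreover have "(a, b) \<in> reach (insert {a, b} Z)" by (rule reach_edge) simp
  moreover assume "?R x y"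
  ultimately show "(x, y) \<in> reach (insert {a, b} Z)"
    by (meson reach_sym reach_trans subsetD)
qed

lemma component_eq_iff: "component Z x = component Z y \<longleftrightarrow> (x, y) \<in> reach Z"
  unfolding component_def by (auto intro: reach_sym reach_trans)

text \<open>Taking images under the larger reachability sends a component of \<open>Z\<close> to the
  component of \<open>Z'\<close> containing it; the component counts below are compared through this
  map.\<close>

lemma reach_Image_component:
  assumes "Z \<subseteq> Z'"
  shows "reach Z' `` component Z x = component Z' x"
  using reach_mono[OF assms] by (auto simp: component_def intro: reach_trans)

lemma finite_components [simp]: "finite V \<Longrightarrow> finite (graph_components V Z)"
  by (simp add: graph_components_def)

text \<open>Only the components of \<open>a\<close> and \<open>b\<close> can merge, so the map
  between components is injective once that of \<open>b\<close> is left out.\<close>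

lemma components_insert_le:
  assumes "finite V" "b \<in> V"
  shows "card (graph_components V Z) \<le> card (graph_components V (insert {a, b} Z)) + 1"
proof -
  let ?Z = "insert {a, b} Z"
  have img: "reach ?Z `` component Z x = component ?Z x" for x
    by (rule reach_Image_component) auto
  have "inj_on (\<lambda>C. reach ?Z `` C) (graph_components V Z - {component Z b})"
  proof (rule inj_onI)
    fix C D
    assume C: "C \<in> graph_components V Z - {component Z b}"
      and D: "D \<in> graph_components V Z - {component Z b}"
      and eq: "reach ?Z `` C = reach ?Z `` D"
    from C D obtain x y where xy: "C = component Z x" "D = component Z y"
      by (auto simp: graph_components_def)
    \<comment> \<open>These facts exclude both alternatives of \<open>reach_insert\<close> that
      cross the new edge.\<close>
    with C D have "(x, b) \<notin> reach Z" "(b, y) \<notin> reach Z"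
      by (auto simp: component_eq_iff dest: reach_sym)
    moreover have "(x, y) \<in> reach ?Z"
      using eq by (simp add: xy img component_eq_iff)
    ultimately show "C = D"
      by (simp add: xy reach_insert component_eq_iff)
  qed
  moreover have "(\<lambda>C. reach ?Z `` C) ` (graph_components V Z - {component Z b}) \<subseteq> graph_components V ?Z"
    by (auto simp: graph_components_def img)
  ultimately have "card (graph_components V Z - {component Z b}) \<le> card (graph_components V ?Z)"
    using assms by (intro card_inj_on_le) auto
  moreover have "component Z b \<in> graph_components V Z"
    using assms by (simp add: graph_components_def)
  ultimately show ?thesis using assms by (simp add: card_Diff_singleton)
qed

text \<open>The component of \<open>a\<close> already maps to the merged one, so leaving out that of
  \<open>b\<close> keeps the map surjective.\<close>

lemma components_insert_less:
  assumes "finite V" "a \<in> V" "b \<in> V" "(a, b) \<notin> reach Z"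
  shows "card (graph_components V (insert {a, b} Z)) < card (graph_components V Z)"
proof -
  let ?Z = "insert {a, b} Z"
  have img: "reach ?Z `` component Z x = component ?Z x" for x
    by (rule reach_Image_component) auto
  have "graph_components V ?Z \<subseteq> (\<lambda>C. reach ?Z `` C) ` (graph_components V Z - {component Z b})"
  proof
    fix C assume "C \<in> graph_components V ?Z"
    then obtain x where x: "x \<in> V" "C = component ?Z x" by (auto simp: graph_components_def)
    \<comment> \<open>The representative moves to \<open>a\<close> exactly when \<open>x\<close>
      lies in the omitted component of \<open>b\<close>.\<close>
    define y where "y = (if (x, b) \<in> reach Z then a else x)"
    have "(x, y) \<in> reach ?Z" "(y, b) \<notin> reach Z" "y \<in> V"
      using assms x by (auto simp: y_def reach_insert)
    then have "C = reach ?Z `` component Z y" "component Z y \<in> graph_components V Z - {component Z b}"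
      by (auto simp: img x component_eq_iff graph_components_def)
    then show "C \<in> (\<lambda>C. reach ?Z `` C) ` (graph_components V Z - {component Z b})" by blast
  qed
  then have "card (graph_components V ?Z) \<le> card (graph_components V Z - {component Z b})"
    using assms by (intro surj_card_le) auto
  also have "\<dots> < card (graph_components V Z)"
    using assms by (intro card_Diff1_less) (auto simp: graph_components_def)
  finally show ?thesis .
qed

lemma simple_graphE:
  assumes "simple_graph V E" "e \<in> E"
  obtains a b where "a \<in> V" "b \<in> V" "a \<noteq> b" "e = {a, b}"
proof -
  have "e \<subseteq> V" "card e = 2" using assms by (auto simp: simple_graph_def)
  then show thesis using that by (auto simp: card_2_iff)
qed

lemma simple_graph_finite: "simple_graph V E \<Longrightarrow> finite V" "simple_graph V E \<Longrightarrow> finite E"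
  by (auto simp: simple_graph_def intro: finite_subset[of E "Pow V"])

lemma simple_graph_mono: "simple_graph V E \<Longrightarrow> Z \<subseteq> E \<Longrightarrow> simple_graph V Z"
  by (auto simp: simple_graph_def)

text \<open>Without edges every vertex is a component, and each added edge lowers the count by at
  most one.\<close>

lemma card_vertices_le:
  assumes "simple_graph V Z"
  shows "card V \<le> card (graph_components V Z) + card Z"
proof -
  have "finite Z" by (rule simple_graph_finite[OF assms])
  then show ?thesis using assms
  proof (induction Z rule: finite_induct)
    case empty
    have "component {} x = {x}" for x :: 'a by (auto simp: component_def reach_def)
    then show ?case by (simp add: graph_components_def card_image inj_on_def)
  next
    case (insert e Z)
    obtain a b where ab: "a \<in> V" "b \<in> V" "e = {a, b}"
      using insert.prems by (elim simple_graphE[of V _ e]) auto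
    have "simple_graph V Z" using insert.prems by (rule simple_graph_mono) auto
    with insert.IH components_insert_le[of V b Z a] simple_graph_finite(1) ab insert.hyps
    show ?case by force
  qed
qed

lemma connected_card_edges:
  assumes "simple_graph V Z" "connected_graph V Z"
  shows "card V \<le> card Z + 1"
proof -
  obtain v where v: "v \<in> V" using assms(2) by (auto simp: connected_graph_def)
  have "graph_components V Z \<subseteq> {component Z v}"
    unfolding graph_components_def
  proof (rule image_subsetI)
    fix x assume "x \<in> V"
    with assms(2) v have "(x, v) \<in> reach Z" by (auto simp: connected_graph_iff_reach)
    then show "component Z x \<in> {component Z v}" by (simp add: component_eq_iff)
  qed
  then have "card (graph_components V Z) \<le> card {component Z v}" by (rule card_mono[rotated]) simp
  with card_vertices_le[OF assms(1)] show ?thesis by simp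
qed

text \<open>While the graph is disconnected, some edge of \<open>E\<close> joins two components;
  adding it lowers the count, which never falls below one.\<close>

lemma connect_components:
  assumes "simple_graph V E" "connected_graph V E" "Z \<subseteq> E"
  shows "\<exists>F\<subseteq>E. connected_graph V (Z \<union> F) \<and> card F + 1 \<le> card (graph_components V Z)"
  using assms(3)
proof (induction "card (graph_components V Z)" arbitrary: Z rule: less_induct)
  case less
  have V: "finite V" "V \<noteq> {}"
    using assms by (auto simp: connected_graph_def simple_graph_finite)
  show ?case
  proof (cases "connected_graph V Z")
    case True
    have "graph_components V Z \<noteq> {}" using V by (simp add: graph_components_def)
    then have "0 < card (graph_components V Z)" using V by (simp add: card_gt_0_iff)
    with True show ?thesis by (intro exI[of _ "{}"]) auto
  next
    case False
    then have "\<not> reach E \<subseteq> reach Z"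
      using assms(2) by (auto simp: connected_graph_iff_reach)
    \<comment> \<open>If every edge of \<open>E\<close> had its ends connected in \<open>Z\<close>,
      \<open>reach_subset\<close> would yield the excluded inclusion.\<close>
    then have "\<exists>x y. {x, y} \<in> E \<and> (x, y) \<notin> reach Z"
      by (rule contrapos_np) (rule reach_subset, simp)
    then obtain x y where xy: "{x, y} \<in> E" "(x, y) \<notin> reach Z"
      by blast
    have "{x, y} \<subseteq> V" using assms(1) xy(1) by (auto simp: simple_graph_def)
    then have lt: "card (graph_components V (insert {x, y} Z)) < card (graph_components V Z)"
      using components_insert_less[of V x y Z] V xy by simp
    then obtain F where F: "F \<subseteq> E" "connected_graph V (insert {x, y} Z \<union> F)"
      "card F + 1 \<le> card (graph_components V (insert {x, y} Z))"
      using less.hyps[OF lt] less.prems xy(1) by auto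
    have "card (insert {x, y} F) \<le> card F + 1" by (simp add: card_insert_le_m1)
    with F(3) lt have "card (insert {x, y} F) + 1 \<le> card (graph_components V Z)" by linarith
    moreover have "insert {x, y} F \<subseteq> E" "connected_graph V (Z \<union> insert {x, y} F)"
      using F(1,2) xy(1) by simp_all
    ultimately show ?thesis by blast
  qed
qed

section \<open>Existence of spanning trees\<close>

text \<open>The rest of the cycle still joins the ends of \<open>{p ! 0, p ! 1}\<close>, so that
  edge can be deleted.\<close>

lemma connected_remove_cycle_edge:
  assumes "connected_graph V H" "is_cycle H p"
  shows "\<exists>e\<in>H. connected_graph V (H - {e})"
proof -
  let ?k = "length p"
  let ?e = "{p ! 0, p ! 1}"
  have k: "3 \<le> ?k" and dist: "distinct p"
    and edge: "\<And>i. i < ?k \<Longrightarrow> {p ! i, p ! (Suc i mod ?k)} \<in> H"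
    using assms(2) by (auto simp: is_cycle_def)
  \<comment> \<open>The closing edge differs from \<open>?e\<close> because the length is at least
    3; the other edges avoid \<open>p ! 0\<close>.\<close>
  have edge_step: "(p ! i, p ! (Suc i mod ?k)) \<in> reach (H - {?e})" if "1 \<le> i" "i < ?k" for i
  proof (rule reach_edge)
    have "{p ! i, p ! (Suc i mod ?k)} \<noteq> ?e"
    proof (cases "Suc i = ?k")
      case True
      with that k dist show ?thesis
        by (auto simp: doubleton_eq_iff nth_eq_iff_index_eq)
    next
      case False
      then have "Suc i mod ?k = Suc i" using that by simp
      moreover have "p ! i \<noteq> p ! 0" "p ! Suc i \<noteq> p ! 0"
        using False that dist
          nth_eq_iff_index_eq[of p i 0] nth_eq_iff_index_eq[of p "Suc i" 0] by fastforce+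
      ultimately show ?thesis by (auto simp: doubleton_eq_iff)
    qed
    with edge that show "{p ! i, p ! (Suc i mod ?k)} \<in> H - {?e}" by simp
  qed
  have path: "(p ! 1, p ! i) \<in> reach (H - {?e})" if "1 \<le> i" "i < ?k" for i
    using that
  proof (induction i rule: dec_induct)
    case (step i)
    then have "(p ! 1, p ! i) \<in> reach (H - {?e})" "(p ! i, p ! Suc i) \<in> reach (H - {?e})"
      using edge_step[of i] by simp_all
    then show ?case by (rule reach_trans)
  qed simp
  have "1 \<le> ?k - 1" "?k - 1 < ?k" using k by auto
  moreover from this have "Suc (?k - 1) = ?k" by simp
  then have "Suc (?k - 1) mod ?k = 0" by (metis mod_self)
  ultimately have "(p ! (?k - 1), p ! 0) \<in> reach (H - {?e})" "(p ! 1, p ! (?k - 1)) \<in> reach (H - {?e})"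
    using edge_step[of "?k - 1"] path[of "?k - 1"] by simp_all
  then have "(p ! 1, p ! 0) \<in> reach (H - {?e})" by (metis reach_trans)
  have "reach H \<subseteq> reach (H - {?e})"
  proof (rule reach_subset)
    fix x y assume "{x, y} \<in> H"
    show "(x, y) \<in> reach (H - {?e})"
    proof (cases "{x, y} = ?e")
      case True
      with \<open>(p ! 1, p ! 0) \<in> _\<close> show ?thesis
        by (auto simp: doubleton_eq_iff intro: reach_sym)
    next
      case False
      with \<open>{x, y} \<in> H\<close> show ?thesis by (intro reach_edge) simp
    qed
  qed
  moreover have "0 < ?k" "Suc 0 mod ?k = 1" using k by auto
  then have "?e \<in> H" using edge[of 0] by metis
  ultimately show ?thesis
    using assms(1) unfolding connected_graph_iff_reach by (meson order_trans)
qed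

text \<open>Cycle edges are deleted until no cycle is left; finiteness makes this stop.\<close>

lemma connected_contains_spanning_tree:
  assumes "simple_graph V H" "connected_graph V H"
  shows "\<exists>T. spanning_tree V H T"
proof -
  have "finite H" by (rule simple_graph_finite[OF assms(1)])
  then show ?thesis using assms
  proof (induction H rule: finite_psubset_induct)
    case (psubset H)
    show ?case
    proof (cases "\<exists>p. is_cycle H p")
      case True
      then obtain e where e: "e \<in> H" "connected_graph V (H - {e})"
        using connected_remove_cycle_edge psubset.prems by blast
      moreover have "simple_graph V (H - {e})"
        using psubset.prems(1) by (rule simple_graph_mono) auto
      ultimately obtain T where "spanning_tree V (H - {e}) T"
        using psubset.IH[of "H - {e}"] by auto
      then show ?thesis by (auto simp: spanning_tree_def)
    next
      case False
      with psubset.prems show ?thesis by (auto simp: spanning_tree_def is_tree_def)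
    qed
  qed
qed

text \<open>The error guarantee quantifies over minimum spanning trees, so it yields a bound only
  once one exists.\<close>

lemma min_spanning_tree_exists:
  assumes "simple_graph V E" "connected_graph V E"
  shows "\<exists>T. min_spanning_tree V E w T"
proof -
  let ?S = "{T. spanning_tree V E T}"
  have fin: "finite ?S"
    by (rule finite_subset[of _ "Pow E"])
      (use simple_graph_finite[OF assms(1)] in \<open>auto simp: spanning_tree_def\<close>)
  have "?S \<noteq> {}" using connected_contains_spanning_tree[OF assms] by auto
  with fin have "arg_min_on (sum w) ?S \<in> ?S" by (rule arg_min_if_finite(1))
  moreover have "sum w (arg_min_on (sum w) ?S) \<le> sum w T'" if "T' \<in> ?S" for T'
    using that by (intro arg_min_least[OF fin]) auto
  ultimately show ?thesis unfolding min_spanning_tree_def by blast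
qed

section \<open>Component counts and degrees\<close>

text \<open>The vertices of a component share a total weight of one equally, and the component
  contains each of them with all its neighbours.\<close>

lemma components_le_sum_inverse_degree:
  assumes "simple_graph V Z"
  shows "real (card (graph_components V Z)) \<le> (\<Sum>v\<in>V. 1 / (1 + real (card {e \<in> Z. v \<in> e})))"
proof -
  have V: "finite V" and Z: "finite Z" using assms by (auto simp: simple_graph_finite)
  have comp_V: "component Z v \<subseteq> V" if "v \<in> V" for v
  proof
    fix u assume "u \<in> component Z v"
    then have "(v, u) \<in> {(x, y). {x, y} \<in> Z}\<^sup>*" by (simp add: component_def reach_def)
    then show "u \<in> V"
      by (induction rule: rtrancl_induct) (use that assms in \<open>auto simp: simple_graph_def\<close>)
  qed
  have deg: "1 + card {e \<in> Z. v \<in> e} \<le> card (component Z v)" if v: "v \<in> V" for v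
  proof -
    let ?N = "{u. {v, u} \<in> Z}"
    have fin_comp: "finite (component Z v)" using comp_V[OF v] V by (rule finite_subset)
    have sub: "insert v ?N \<subseteq> component Z v"
      by (auto simp: component_def intro: reach_edge)
    from finite_subset[OF this fin_comp] have fin: "finite ?N" by simp
    have le: "card (insert v ?N) \<le> card (component Z v)" by (rule card_mono[OF fin_comp sub])
    have "{e \<in> Z. v \<in> e} \<subseteq> (\<lambda>u. {v, u}) ` ?N"
    proof
      fix e assume "e \<in> {e \<in> Z. v \<in> e}"
      then have e: "e \<in> Z" "v \<in> e" by auto
      then obtain a b where "e = {a, b}" using simple_graphE[OF assms] by metis
      with e show "e \<in> (\<lambda>u. {v, u}) ` ?N" by (auto simp: insert_commute)
    qed
    then have "card {e \<in> Z. v \<in> e} \<le> card ?N" by (rule surj_card_le[OF fin])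
    \<comment> \<open>Without loops, \<open>v\<close> is one element beyond its neighbours, which
      gives the summand 1.\<close>
    moreover have "v \<notin> ?N" using assms by (auto simp: simple_graph_def dest: bspec)
    ultimately show ?thesis using le fin by simp
  qed
  have "real (card (graph_components V Z)) =
      (\<Sum>C\<in>graph_components V Z. \<Sum>v\<in>{v \<in> V. component Z v = C}.
        1 / real (card (component Z v)))"
  proof -
    have "(\<Sum>v\<in>{v \<in> V. component Z v = C}. 1 / real (card (component Z v))) = 1"
      if "C \<in> graph_components V Z" for C
    proof -
      from that obtain x where x: "x \<in> V" "C = component Z x" by (auto simp: graph_components_def)
      have "{v \<in> V. component Z v = C} = C"
        using comp_V[OF x(1)] by (auto simp: x component_eq_iff) (auto simp: component_def dest: reach_sym)
      \<comment> \<open>Needed for the equal shares to add up to one, since division by zero gives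
        0.\<close>
      moreover have "card C > 0" using deg x by force
      moreover have "(\<Sum>v\<in>{v \<in> V. component Z v = C}. 1 / real (card (component Z v))) =
        (\<Sum>v\<in>{v \<in> V. component Z v = C}. 1 / real (card C))"
        by (intro sum.cong) auto
      ultimately show ?thesis by simp
    qed
    then have "(\<Sum>C\<in>graph_components V Z. \<Sum>v\<in>{v \<in> V. component Z v = C}.
          1 / real (card (component Z v))) =
        (\<Sum>C\<in>graph_components V Z. 1)"
      by (rule sum.cong[OF refl])
    then show ?thesis by simp
  qed
  also have "\<dots> = (\<Sum>v\<in>V. 1 / real (card (component Z v)))"
    unfolding graph_components_def by (rule sum.image_gen[OF V, symmetric])
  also have "\<dots> \<le> (\<Sum>v\<in>V. 1 / (1 + real (card {e \<in> Z. v \<in> e})))"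
  proof (intro sum_mono divide_left_mono)
    fix v assume "v \<in> V"
    then have "real (1 + card {e \<in> Z. v \<in> e}) \<le> real (card (component Z v))"
      using deg of_nat_le_iff by blast
    then show "1 + real (card {e \<in> Z. v \<in> e}) \<le> real (card (component Z v))"
      "0 < real (card (component Z v)) * (1 + real (card {e \<in> Z. v \<in> e}))"
      by (auto intro!: mult_pos_pos)
  qed simp_all
  finally show ?thesis .
qed

section \<open>Averaging over edge subsets\<close>

text \<open>Each subset avoiding \<open>e\<close> is paired with the one that adds \<open>e\<close>;
  the privacy comparison is later made within such a pair.\<close>

lemma sum_Pow_split:
  fixes f :: "'b set \<Rightarrow> real"
  assumes "finite E" "e \<in> E"
  shows "(\<Sum>Z\<in>Pow E. f Z) = (\<Sum>Z\<in>Pow (E - {e}). f Z + f (insert e Z))"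
proof -
  have "Pow E = Pow (E - {e}) \<union> insert e ` Pow (E - {e})"
    using assms(2) Pow_insert[of e "E - {e}"] by (simp add: insert_absorb)
  moreover have "Pow (E - {e}) \<inter> insert e ` Pow (E - {e}) = {}" by auto
  moreover have "inj_on (insert e) (Pow (E - {e}))" by (auto simp: inj_on_def)
  ultimately show ?thesis
    using assms(1) by (simp add: sum.union_disjoint sum.reindex sum.distrib)
qed

text \<open>This is the mean of 1/(1 + B) for B binomial with success probability 1/2: absorption
  turns each term into an entry of the next row of Pascal's triangle.\<close>

lemma sum_Pow_inverse_card:
  assumes "finite D"
  shows "(\<Sum>X\<in>Pow D. 1 / (1 + real (card X))) \<le> 2 ^ card D * (2 / (real (card D) + 1))"
proof -
  let ?d = "card D"
  have "(\<Sum>X\<in>Pow D. 1 / (1 + real (card X))) =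
      (\<Sum>k\<le>?d. \<Sum>X\<in>{X \<in> Pow D. card X = k}. 1 / (1 + real (card X)))"
    using assms by (intro sum.group[symmetric]) (auto simp: card_mono)
  also have "\<dots> = (\<Sum>k\<le>?d. real (Suc ?d choose Suc k) / (real ?d + 1))"
  proof (intro sum.cong refl)
    fix k
    have "(\<Sum>X\<in>{X \<in> Pow D. card X = k}. 1 / (1 + real (card X))) = real (?d choose k) / (1 + real k)"
      using n_subsets[OF assms, of k] by simp
    also have "\<dots> = real (Suc ?d choose Suc k) / (real ?d + 1)"
    proof -
      have "real (Suc k * (Suc ?d choose Suc k)) = real (Suc ?d * (?d choose k))"
        by (simp only: Suc_times_binomial)
      then show ?thesis by (simp add: field_simps)
    qed
    finally show "(\<Sum>X\<in>{X \<in> Pow D. card X = k}. 1 / (1 + real (card X))) =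
      real (Suc ?d choose Suc k) / (real ?d + 1)" .
  qed
  also have "\<dots> = (\<Sum>k\<le>?d. real (Suc ?d choose Suc k)) / (real ?d + 1)"
    by (simp add: sum_divide_distrib)
  also have "\<dots> \<le> 2 ^ Suc ?d / (real ?d + 1)"
  proof (rule divide_right_mono)
    \<comment> \<open>The row lacks only its entry for \<open>k = 0\<close>, which is added to reach
      the full row sum.\<close>
    have "(\<Sum>k\<le>?d. Suc ?d choose Suc k) \<le> (\<Sum>k\<le>Suc ?d. Suc ?d choose k)"
      by (simp add: sum.atMost_Suc_shift del: sum.atMost_Suc binomial_Suc_Suc)
    also have "\<dots> = 2 ^ Suc ?d" by (rule choose_row_sum)
    finally have "real (\<Sum>k\<le>?d. Suc ?d choose Suc k) \<le> real (2 ^ Suc ?d)"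
      using of_nat_le_iff by blast
    then show "(\<Sum>k\<le>?d. real (Suc ?d choose Suc k)) \<le> 2 ^ Suc ?d" by simp
  qed simp
  finally show ?thesis by (simp add: mult.commute)
qed

text \<open>A uniformly random subset of \<open>E\<close> has a uniformly random trace on
  \<open>D\<close>: elements outside \<open>D\<close> are chosen freely.\<close>

lemma sum_Pow_Int:
  fixes f :: "'b set \<Rightarrow> real"
  assumes "finite E" "D \<subseteq> E"
  shows "(\<Sum>Z\<in>Pow E. f (Z \<inter> D)) = 2 ^ card (E - D) * (\<Sum>X\<in>Pow D. f X)"
proof -
  have "(\<Sum>Z\<in>Pow (R \<union> D). f (Z \<inter> D)) = 2 ^ card R * (\<Sum>X\<in>Pow D. f X)"
    if "finite R" "R \<inter> D = {}" for R
    using that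
  proof (induction R rule: finite_induct)
    case empty
    then show ?case by (auto intro!: sum.cong simp: Int_absorb2)
  next
    case (insert e R)
    have "finite D" using assms finite_subset by blast
    then have "(\<Sum>Z\<in>Pow (insert e R \<union> D). f (Z \<inter> D)) =
        (\<Sum>Z\<in>Pow (insert e R \<union> D - {e}). f (Z \<inter> D) + f (insert e Z \<inter> D))"
      using insert.hyps by (intro sum_Pow_split) auto
    also have "insert e R \<union> D - {e} = R \<union> D" using insert by auto
    also have "(\<Sum>Z\<in>Pow (R \<union> D). f (Z \<inter> D) + f (insert e Z \<inter> D)) =
        2 * (\<Sum>Z\<in>Pow (R \<union> D). f (Z \<inter> D))"
      using insert.prems by (simp add: sum_distrib_left)
    finally show ?case using insert by simp
  qed
  from this[of "E - D"] assms show ?thesis by (simp add: Un_absorb2 Diff_disjoint Int_commute)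
qed

text \<open>By linearity the vertices are averaged separately, and only the edges at
  \<open>v\<close> affect the term of \<open>v\<close>.\<close>

lemma sum_components_le:
  assumes "simple_graph V E" and deg: "\<And>v. v \<in> V \<Longrightarrow> d \<le> card {e \<in> E. v \<in> e}"
  shows "(\<Sum>Z\<in>Pow E. real (card (graph_components V Z))) \<le> 2 ^ card E * (real (card V) * (2 / (real d + 1)))"
proof -
  have V: "finite V" and E: "finite E" using assms by (auto simp: simple_graph_finite)
  have "(\<Sum>Z\<in>Pow E. real (card (graph_components V Z))) \<le>
      (\<Sum>Z\<in>Pow E. \<Sum>v\<in>V. 1 / (1 + real (card {e \<in> Z. v \<in> e})))"
    using simple_graph_mono[OF assms(1)]
    by (intro sum_mono components_le_sum_inverse_degree) auto
  also have "\<dots> = (\<Sum>v\<in>V. \<Sum>Z\<in>Pow E. 1 / (1 + real (card {e \<in> Z. v \<in> e})))"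
    by (rule sum.swap)
  also have "\<dots> \<le> (\<Sum>v\<in>V. 2 ^ card E * (2 / (real d + 1)))"
  proof (rule sum_mono)
    fix v assume v: "v \<in> V"
    let ?D = "{e \<in> E. v \<in> e}"
    have D: "finite ?D" "?D \<subseteq> E" using E by auto
    have "(\<Sum>Z\<in>Pow E. 1 / (1 + real (card {e \<in> Z. v \<in> e}))) =
        (\<Sum>Z\<in>Pow E. 1 / (1 + real (card (Z \<inter> ?D))))"
      by (intro sum.cong arg_cong[where f = "\<lambda>X. 1 / (1 + real (card X))"]) auto
    also have "\<dots> = 2 ^ card (E - ?D) * (\<Sum>X\<in>Pow ?D. 1 / (1 + real (card X)))"
      by (rule sum_Pow_Int[OF E D(2), of "\<lambda>X. 1 / (1 + real (card X))"])
    also have "\<dots> \<le> 2 ^ card (E - ?D) * (2 ^ card ?D * (2 / (real (card ?D) + 1)))"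
      by (intro mult_left_mono sum_Pow_inverse_card D) simp
    also have "\<dots> = 2 ^ card E * (2 / (real (card ?D) + 1))"
      using E D card_mono[OF E D(2)]
      by (simp add: card_Diff_subset power_add[symmetric] flip: mult.assoc)
    also have "\<dots> \<le> 2 ^ card E * (2 / (real d + 1))"
      using deg[OF v] by (intro mult_left_mono divide_left_mono) auto
    finally show "(\<Sum>Z\<in>Pow E. 1 / (1 + real (card {e \<in> Z. v \<in> e}))) \<le> 2 ^ card E * (2 / (real d + 1))" .
  qed
  finally show ?thesis by (simp add: ac_simps)
qed

section \<open>Degrees\<close>

text \<open>The edges at \<open>v\<close> include the cut separating \<open>v\<close> from the rest,
  which is nonempty as there are two vertices.\<close>

lemma min_cut_le_degree:
  assumes "simple_graph V E" "2 \<le> card V" "v \<in> V"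
  shows "min_cut V E \<le> card {e \<in> E. v \<in> e}"
proof -
  let ?C = "{card (edges_between E A B) | A B. A \<union> B = V \<and> A \<inter> B = {} \<and> A \<noteq> {} \<and> B \<noteq> {}}"
  have "?C \<subseteq> (\<lambda>(A, B). card (edges_between E A B)) ` (Pow V \<times> Pow V)" by auto
  then have "finite ?C"
    by (rule finite_subset) (use simple_graph_finite[OF assms(1)] in auto)
  moreover have "V - {v} \<noteq> {}"
  proof
    assume "V - {v} = {}"
    then have "card V \<le> card {v}" by (intro card_mono) auto
    with assms(2) show False by simp
  qed
  then have "card (edges_between E {v} (V - {v})) \<in> ?C" using assms(3) by blast
  ultimately have "min_cut V E \<le> card (edges_between E {v} (V - {v}))"
    unfolding min_cut_def by (rule Min_le)
  also have "\<dots> \<le> card {e \<in> E. v \<in> e}"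
    using simple_graph_finite[OF assms(1)]
    by (intro card_mono) (auto simp: edges_between_def)
  finally show ?thesis .
qed

text \<open>Turns a lower bound on a degree into one on the number of vertices, as the bootstrap
  below requires.\<close>

lemma degree_less_card:
  assumes "simple_graph V E" "v \<in> V"
  shows "card {e \<in> E. v \<in> e} < card V"
proof -
  have V: "finite V" using assms by (simp add: simple_graph_finite)
  have "{e \<in> E. v \<in> e} \<subseteq> (\<lambda>u. {v, u}) ` (V - {v})"
  proof
    fix e assume "e \<in> {e \<in> E. v \<in> e}"
    then have e: "e \<in> E" "v \<in> e" by auto
    then obtain a b where "a \<in> V" "b \<in> V" "a \<noteq> b" "e = {a, b}"
      using simple_graphE[OF assms(1)] by metis
    with e show "e \<in> (\<lambda>u. {v, u}) ` (V - {v})" by (auto simp: insert_commute)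
  qed
  then have "card {e \<in> E. v \<in> e} \<le> card (V - {v})" using V by (intro surj_card_le) auto
  also have "\<dots> < card V" using V assms(2) by (rule card_Diff1_less)
  finally show ?thesis .
qed

lemma card_edges_le:
  assumes "simple_graph V E"
  shows "card E \<le> card V choose 2"
proof -
  have V: "finite V" using assms by (simp add: simple_graph_finite)
  have "card E \<le> card {e. e \<subseteq> V \<and> card e = 2}"
    using V assms by (intro card_mono) (auto simp: simple_graph_def)
  with n_subsets[OF V, of 2] show ?thesis by simp
qed

text \<open>Bootstraps \<open>d \<ge> 5 log n\<close> against \<open>n > d\<close>, starting from \<open>n \<ge> 4\<close>.\<close>

lemma degree_ge_20:
  assumes "simple_graph V E" "card E > card V"
    and cut: "5 * log 2 (real (card V)) \<le> real (min_cut V E)" and v: "v \<in> V"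
  shows "20 \<le> card {e \<in> E. v \<in> e}"
proof -
  let ?n = "card V" and ?d = "card {e \<in> E. v \<in> e}"
  \<comment> \<open>More edges than vertices is impossible on at most three vertices, where
    \<open>k choose 2\<close> is at most \<open>k\<close>.\<close>
  have "?n < ?n choose 2" using card_edges_le[OF assms(1)] assms(2) by simp
  moreover have "k \<in> {0, 1, 2, 3}" if "k < 4" for k :: nat using that by auto
  then have "k choose 2 \<le> k" if "k < 4" for k :: nat using that by (fastforce simp: choose_two)
  ultimately have n4: "4 \<le> ?n" by (meson not_le)
  have "?d < ?n" by (rule degree_less_card) fact+
  have "min_cut V E \<le> ?d" using n4 by (intro min_cut_le_degree assms) auto
  then have *: "5 * log 2 (real ?n) \<le> real ?d" using cut by simp
  have grow: "5 * k \<le> ?d" if "2 ^ k \<le> ?n" for k :: nat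
  proof -
    have "2 ^ k \<le> real ?n" using that by (metis of_nat_le_iff of_nat_numeral of_nat_power)
    then have "log 2 (2 ^ k) \<le> log 2 (real ?n)" by (intro log_mono) auto
    with * have "real (5 * k) \<le> real ?d" by simp
    then show ?thesis by linarith
  qed
  have "10 \<le> ?d" using grow[of 2] n4 by simp
  then have "15 \<le> ?d" using grow[of 3] \<open>?d < ?n\<close> by simp
  then show ?thesis using grow[of 4] \<open>?d < ?n\<close> by simp
qed

section \<open>Privacy\<close>

text \<open>Group privacy: \<open>k\<close> unit steps multiply the factors. Each step contributes
  \<open>\<delta>\<close> times a factor of at most \<open>exp (real k * \<epsilon>)\<close>, which
  gives the coarse additive term.\<close>

lemma differentially_private_shift_edge:
  assumes dp: "differentially_private E \<epsilon> \<delta> \<A>" and E: "finite E" "e \<in> E"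
    and w: "w \<in> weight_vectors E" and nonneg: "0 \<le> \<epsilon>" "0 \<le> \<delta>"
  shows "measure_pmf.prob (\<A> w) Y \<le>
    exp (real k * \<epsilon>) * measure_pmf.prob (\<A> (w(e := w e + real k))) Y + real k * exp (real k * \<epsilon>) * \<delta>"
proof (induction k)
  case (Suc k)
  let ?w = "\<lambda>k. w(e := w e + real k)"
  let ?p = "\<lambda>k. measure_pmf.prob (\<A> (?w k)) Y"
  have mem: "?w k \<in> weight_vectors E" for k using w E by (auto simp: PiE_def extensional_def)
  have "(\<Sum>f\<in>E. \<bar>?w k f - ?w (Suc k) f\<bar>) = (\<Sum>f\<in>E. if f = e then 1 else 0)"
    by (intro sum.cong) auto
  also have "\<dots> = 1" using E by simp
  finally have "neighboring E (?w k) (?w (Suc k))" by (simp add: neighboring_def)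
  then have "?p k \<le> exp \<epsilon> * ?p (Suc k) + \<delta>"
    using dp mem unfolding differentially_private_def by blast
  then have "exp (real k * \<epsilon>) * ?p k \<le> exp (real k * \<epsilon>) * (exp \<epsilon> * ?p (Suc k) + \<delta>)"
    by (intro mult_left_mono) auto
  also have "\<dots> = exp (real (Suc k) * \<epsilon>) * ?p (Suc k) + exp (real k * \<epsilon>) * \<delta>"
    by (simp add: algebra_simps exp_add)
  finally have "measure_pmf.prob (\<A> w) Y \<le>
      exp (real (Suc k) * \<epsilon>) * ?p (Suc k) + exp (real k * \<epsilon>) * \<delta> + real k * exp (real k * \<epsilon>) * \<delta>"
    using Suc.IH by linarith
  also have "\<dots> = exp (real (Suc k) * \<epsilon>) * ?p (Suc k) + real (Suc k) * exp (real k * \<epsilon>) * \<delta>"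
    by (simp only: of_nat_Suc distrib_right distrib_left mult_1 add_ac)
  finally have "measure_pmf.prob (\<A> w) Y \<le>
      exp (real (Suc k) * \<epsilon>) * ?p (Suc k) + real (Suc k) * exp (real k * \<epsilon>) * \<delta>" .
  moreover have "real (Suc k) * exp (real k * \<epsilon>) * \<delta> \<le> real (Suc k) * exp (real (Suc k) * \<epsilon>) * \<delta>"
    using nonneg by (intro mult_right_mono mult_left_mono) (auto simp: algebra_simps)
  ultimately show ?case by linarith
qed simp

text \<open>Linearity expresses expected weight through the events \<open>{T. e \<in> T}\<close>, to
  which privacy applies. Finite support gives integrability.\<close>

lemma expectation_sum_weights:
  fixes w :: "'b \<Rightarrow> real"
  assumes "finite E" "set_pmf p \<subseteq> Pow E"
  shows "measure_pmf.expectation p (\<lambda>T. sum w T) = (\<Sum>e\<in>E. w e * measure_pmf.prob p {T. e \<in> T})"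
proof -
  have fin: "finite (set_pmf p)" using assms finite_subset by blast
  have "measure_pmf.expectation p (\<lambda>T. sum w T) =
      measure_pmf.expectation p (\<lambda>T. \<Sum>e\<in>E. w e * indicator {T. e \<in> T} T)"
  proof (rule integral_cong_AE)
    show "AE T in measure_pmf p. sum w T = (\<Sum>e\<in>E. w e * indicator {T. e \<in> T} T)"
    proof (rule AE_pmfI)
      fix T assume "T \<in> set_pmf p"
      then have "T = {e \<in> E. e \<in> T}" using assms by auto
      then have "sum w T = (\<Sum>e\<in>{e \<in> E. e \<in> T}. w e)" by simp
      also have "\<dots> = (\<Sum>e\<in>E. w e * indicator {T. e \<in> T} T)"
        using assms by (simp add: sum.If_cases indicator_def Int_def if_distrib cong: if_cong)
      finally show "sum w T = (\<Sum>e\<in>E. w e * indicator {T. e \<in> T} T)" .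
    qed
  qed simp_all
  also have "\<dots> = (\<Sum>e\<in>E. measure_pmf.expectation p (\<lambda>T. w e * indicator {T. e \<in> T} T))"
    by (intro Bochner_Integration.integral_sum integrable_measure_pmf_finite fin)
  finally show ?thesis by simp
qed

text \<open>Bounds the coefficient of \<open>n\<close> in the final inequality: 2/21 comes from
  degree at least 20, the other summand from the allowed error.\<close>

lemma numeric_bound:
  fixes x :: real
  assumes "1 / 2 \<le> x" "x \<le> 1"
  shows "(1 + exp x) * (2 / 21 + 1 / (10 * x)) \<le> 1"
proof -
  have "exp x \<le> 1 + x + x\<^sup>2" using assms by (intro exp_bound) auto
  then have "(1 + exp x) * (2 / 21 + 1 / (10 * x)) \<le> (2 + x + x\<^sup>2) * (2 / 21 + 1 / (10 * x))"
    using assms by (intro mult_right_mono) auto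
  also have "\<dots> = 4 / 21 + 2 / 21 * x + 2 / 21 * x\<^sup>2 + 1 / 5 * (1 / x) + 1 / 10 + x / 10"
    using assms by (simp add: field_simps power2_eq_square)
  also have "\<dots> \<le> 1"
  proof -
    \<comment> \<open>By convexity the square and the reciprocal lie below their chords on [1/2, 1],
      which leaves a linear inequality.\<close>
    have "(x - 1 / 2) * (x - 1) \<le> 0" using assms by (intro mult_nonneg_nonpos) auto
    moreover have "(x - 1 / 2) * (x - 1) = x\<^sup>2 - 3 / 2 * x + 1 / 2"
      by (simp add: field_simps power2_eq_square)
    ultimately have sq: "x\<^sup>2 \<le> 3 / 2 * x - 1 / 2" by linarith
    moreover have "(3 - 2 * x) * x = 3 * x - 2 * x\<^sup>2"
      by (simp add: algebra_simps power2_eq_square)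
    then have "1 \<le> (3 - 2 * x) * x" using sq by linarith
    then have "1 / x \<le> 3 - 2 * x" using assms by (simp add: pos_divide_le_eq)
    ultimately show ?thesis using assms by linarith
  qed
  finally show ?thesis .
qed

section \<open>Lower bound by averaging over weight vectors\<close>

theorem corollary3p4:
  fixes V :: "'a set" and E :: "'a set set" and \<epsilon> \<delta> :: real
  assumes "simple_graph V E" and "connected_graph V E" and "card E > card V"
    and "5 * log 2 (real (card V)) \<le> real (min_cut V E)"
    and "0 < \<epsilon>" and "\<epsilon> \<le> 1"
    and "0 \<le> \<delta>" and "\<delta> \<le> 0.01 * \<epsilon> / real (card E)"
  shows "\<not> (\<exists>\<A> :: ('a set \<Rightarrow> real) \<Rightarrow> 'a set set pmf.
    differentially_private E \<epsilon> \<delta> \<A> \<and>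
    (\<forall>w\<in>weight_vectors E.
      (\<forall>T\<in>set_pmf (\<A> w). spanning_tree V E T) \<and>
      (\<forall>T\<^sub>0. min_spanning_tree V E w T\<^sub>0 \<longrightarrow>
        measure_pmf.expectation (\<A> w) (\<lambda>T. sum w T) - sum w T\<^sub>0
          \<le> 1 / (10 * \<epsilon>) * real (card V))))"
proof
  assume "\<exists>\<A> :: ('a set \<Rightarrow> real) \<Rightarrow> 'a set set pmf.
    differentially_private E \<epsilon> \<delta> \<A> \<and>
    (\<forall>w\<in>weight_vectors E.
      (\<forall>T\<in>set_pmf (\<A> w). spanning_tree V E T) \<and>
      (\<forall>T\<^sub>0. min_spanning_tree V E w T\<^sub>0 \<longrightarrow>
        measure_pmf.expectation (\<A> w) (\<lambda>T. sum w T) - sum w T\<^sub>0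
          \<le> 1 / (10 * \<epsilon>) * real (card V)))"
  then obtain \<A> :: "('a set \<Rightarrow> real) \<Rightarrow> 'a set set pmf" where
    dp: "differentially_private E \<epsilon> \<delta> \<A>" and
    tree: "\<And>w T. w \<in> weight_vectors E \<Longrightarrow> T \<in> set_pmf (\<A> w) \<Longrightarrow> spanning_tree V E T" and
    err: "\<And>w T\<^sub>0. w \<in> weight_vectors E \<Longrightarrow> min_spanning_tree V E w T\<^sub>0 \<Longrightarrow>
      measure_pmf.expectation (\<A> w) (\<lambda>T. sum w T) - sum w T\<^sub>0 \<le> 1 / (10 * \<epsilon>) * real (card V)"
    by blast
  define n where "n = real (card V)"
  define m where "m = card E"
  \<comment> \<open>The largest integer weight with total privacy loss
    \<open>real L * \<epsilon>\<close> at most 1.\<close>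
  define L where "L = nat \<lfloor>1 / \<epsilon>\<rfloor>"
  define x where "x = real L * \<epsilon>"
  define w where "w Z = (\<lambda>e\<in>E. if e \<in> Z then 0 else real L)" for Z
  define P where "P Z e = measure_pmf.prob (\<A> (w Z)) {T. e \<in> T}" for Z e
  \<comment> \<open>Divided by \<open>2 ^ m\<close>, this is the average number of
    weight-\<open>L\<close> edges in the output.\<close>
  define Q where "Q = (\<Sum>Z\<in>Pow E. \<Sum>e\<in>E - Z. P Z e)"
  have E: "finite E" and V: "finite V" using assms(1) by (auto simp: simple_graph_finite)
  have m: "0 < m" using assms(3) by (simp add: m_def)
  have wE: "w Z \<in> weight_vectors E" for Z by (simp add: w_def)
  have supp: "set_pmf (\<A> (w Z)) \<subseteq> Pow E" for Z
    using tree[OF wE] by (auto simp: spanning_tree_def)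

  have "1 \<le> 1 / \<epsilon>" using assms(5,6) by simp
  then have "real L = of_int \<lfloor>1 / \<epsilon>\<rfloor>" "1 \<le> \<lfloor>1 / \<epsilon>\<rfloor>"
    unfolding L_def by linarith+
  then have L: "1 \<le> real L" "real L \<le> 1 / \<epsilon>" "1 / \<epsilon> < real L + 1"
    by linarith+
  have x: "1 / 2 \<le> x" "x \<le> 1"
  proof -
    show "x \<le> 1" using L(2) assms(5) by (simp add: x_def field_simps)
    \<comment> \<open>Rounding down a number that is at least 1 loses less than half of it.\<close>
    have "1 / \<epsilon> \<le> 2 * real L" using L by linarith
    then show "1 / 2 \<le> x" using assms(5) by (simp add: x_def field_simps)
  qed

  have total: "n - 1 \<le> (\<Sum>e\<in>E. P Z e)" for Z
  proof -
    have "n - 1 = measure_pmf.expectation (\<A> (w Z)) (\<lambda>T. n - 1)" by simp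
    also have "\<dots> \<le> measure_pmf.expectation (\<A> (w Z)) (\<lambda>T. \<Sum>e\<in>T. 1)"
    proof (rule integral_mono_AE)
      have fin: "finite (set_pmf (\<A> (w Z)))" using supp E finite_subset by blast
      show "integrable (measure_pmf (\<A> (w Z))) (\<lambda>T. n - 1)"
        "integrable (measure_pmf (\<A> (w Z))) (\<lambda>T. \<Sum>e\<in>T. 1 :: real)"
        by (intro integrable_measure_pmf_finite fin)+
      show "AE T in measure_pmf (\<A> (w Z)). n - 1 \<le> (\<Sum>e\<in>T. 1)"
      proof (rule AE_pmfI)
        fix T assume "T \<in> set_pmf (\<A> (w Z))"
        then have "simple_graph V T" "connected_graph V T"
          using tree[OF wE] by (auto simp: spanning_tree_def is_tree_def)
        then have "card V \<le> card T + 1" by (rule connected_card_edges)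
        then show "n - 1 \<le> (\<Sum>e\<in>T. 1)" by (simp add: n_def)
      qed
    qed
    also have "\<dots> = (\<Sum>e\<in>E. P Z e)"
      \<comment> \<open>Unit weights in \<open>expectation_sum_weights\<close> give the expected
        number of edges.\<close>
      unfolding P_def by (subst expectation_sum_weights[OF E supp]) simp
    finally show ?thesis .
  qed

  have error: "real L * (\<Sum>e\<in>E - Z. P Z e) \<le>
      real L * (real (card (graph_components V Z)) - 1) + real L * (n / (10 * x))" if Z: "Z \<subseteq> E" for Z
  proof -
    \<comment> \<open>A spanning tree inside \<open>Z \<union> F\<close> pays only for edges of
      \<open>F - Z\<close>, so it bounds the optimum from above.\<close>
    obtain F where F: "F \<subseteq> E" "connected_graph V (Z \<union> F)" "card F + 1 \<le> card (graph_components V Z)"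
      using connect_components[OF assms(1,2) Z] by blast
    obtain T where T: "spanning_tree V (Z \<union> F) T"
      using connected_contains_spanning_tree F Z simple_graph_mono[OF assms(1)] by (metis Un_least)
    obtain T0 where T0: "min_spanning_tree V E (w Z) T0"
      using min_spanning_tree_exists[OF assms(1,2)] by blast
    have TE: "spanning_tree V E T" using T F Z by (auto simp: spanning_tree_def)
    have finF: "finite F" using F E finite_subset by blast
    have "sum (w Z) T0 \<le> sum (w Z) T" using T0 TE by (simp add: min_spanning_tree_def)
    also have "\<dots> \<le> (\<Sum>e\<in>Z \<union> F. if e \<in> Z then 0 else real L)"
    proof -
      have "sum (w Z) T = (\<Sum>e\<in>T. if e \<in> Z then 0 else real L)"
        using TE by (intro sum.cong) (auto simp: w_def spanning_tree_def)
      also have "\<dots> \<le> (\<Sum>e\<in>Z \<union> F. if e \<in> Z then 0 else real L)"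
        using T finF Z E by (intro sum_mono2) (auto simp: spanning_tree_def intro: finite_subset)
      finally show ?thesis .
    qed
    also have "\<dots> = (\<Sum>e\<in>F - Z. real L)"
      using finF Z E by (intro sum.mono_neutral_cong_right) (auto intro: finite_subset)
    also have "\<dots> \<le> real L * (real (card (graph_components V Z)) - 1)"
    proof -
      have "card (F - Z) \<le> card F" using finF by (intro card_mono) auto
      then have "real (card (F - Z)) \<le> real (card (graph_components V Z)) - 1" using F(3) by linarith
      then show ?thesis by (simp add: mult.commute mult_left_mono)
    qed
    finally have "sum (w Z) T0 \<le> real L * (real (card (graph_components V Z)) - 1)" .
    moreover have "measure_pmf.expectation (\<A> (w Z)) (\<lambda>T. sum (w Z) T) = real L * (\<Sum>e\<in>E - Z. P Z e)"
    proof -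
      have "measure_pmf.expectation (\<A> (w Z)) (\<lambda>T. sum (w Z) T) = (\<Sum>e\<in>E. w Z e * P Z e)"
        unfolding P_def by (rule expectation_sum_weights[OF E supp])
      also have "\<dots> = (\<Sum>e\<in>E - Z. real L * P Z e)"
        using E by (intro sum.mono_neutral_cong_right) (auto simp: w_def)
      finally show ?thesis by (simp add: sum_distrib_left)
    qed
    \<comment> \<open>Substituting \<open>x = real L * \<epsilon>\<close> exposes a factor
      \<open>L\<close>, which is cancelled in \<open>Q_le\<close>.\<close>
    moreover have "1 / (10 * \<epsilon>) * n = real L * (n / (10 * x))"
      using L assms(5) by (simp add: x_def)
    ultimately show ?thesis using err[OF wE T0] by (simp add: n_def)
  qed

  have Q_le: "Q \<le> 2 ^ m * (n * (2 / 21) - 1 + n / (10 * x))"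
  proof -
    have "Q \<le> (\<Sum>Z\<in>Pow E. real (card (graph_components V Z)) + (n / (10 * x) - 1))"
      unfolding Q_def
    proof (rule sum_mono)
      fix Z assume "Z \<in> Pow E"
      with error[of Z] have "real L * (\<Sum>e\<in>E - Z. P Z e) \<le>
        real L * (real (card (graph_components V Z)) + (n / (10 * x) - 1))"
        by (simp add: algebra_simps)
      then show "(\<Sum>e\<in>E - Z. P Z e) \<le> real (card (graph_components V Z)) + (n / (10 * x) - 1)"
        using L by (simp add: mult_le_cancel_left_pos)
    qed
    also have "\<dots> = (\<Sum>Z\<in>Pow E. real (card (graph_components V Z))) + 2 ^ m * (n / (10 * x) - 1)"
      using E by (simp add: sum.distrib card_Pow m_def)
    also have "(\<Sum>Z\<in>Pow E. real (card (graph_components V Z))) \<le> 2 ^ m * (n * (2 / (real 20 + 1)))"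
      unfolding m_def n_def using degree_ge_20[OF assms(1,3,4)] assms(1) by (intro sum_components_le) auto
    finally show ?thesis by (simp add: algebra_simps)
  qed

  have flip: "P (insert e Z) e \<le> exp x * P Z e + 0.01 * x * exp x / m"
    if "e \<in> E" "Z \<subseteq> E - {e}" for e Z
  proof -
    \<comment> \<open>Taking \<open>e\<close> out of the zero set raises its weight by
      \<open>L\<close>, so \<open>L\<close> unit steps lead from \<open>w (insert e Z)\<close> to
      \<open>w Z\<close>.\<close>
    have shift: "w Z = (w (insert e Z))(e := w (insert e Z) e + real L)"
      using that by (auto simp: w_def fun_eq_iff)
    have "real L * exp x * \<delta> \<le> real L * exp x * (0.01 * \<epsilon> / m)"
      unfolding m_def by (intro mult_left_mono assms) auto
    also have "\<dots> = 0.01 * x * exp x / m" by (simp add: x_def)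
    finally show ?thesis
      using differentially_private_shift_edge[OF dp E that(1) wE, of "insert e Z" "{T. e \<in> T}" L]
        assms(5,7)
      unfolding shift[symmetric] P_def x_def by simp
  qed

  have "2 ^ m * (n - 1) \<le> (1 + exp x) * Q + 2 ^ m * (0.005 * x * exp x)"
  proof -
    \<comment> \<open>Regrouped by edge, \<open>Q\<close> collects exactly the pair members in which
      \<open>e\<close> is expensive.\<close>
    have Q: "Q = (\<Sum>e\<in>E. \<Sum>Z\<in>Pow (E - {e}). P Z e)"
    proof -
      have "Q = (\<Sum>Z\<in>Pow E. \<Sum>e\<in>E. if e \<in> Z then 0 else P Z e)"
        unfolding Q_def using E by (intro sum.cong sum.mono_neutral_cong_left) auto
      also have "\<dots> = (\<Sum>e\<in>E. \<Sum>Z\<in>Pow E. if e \<in> Z then 0 else P Z e)" by (rule sum.swap)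
      also have "\<dots> = (\<Sum>e\<in>E. \<Sum>Z\<in>Pow (E - {e}). P Z e)"
        using E by (intro sum.cong sum.mono_neutral_cong_right) auto
      finally show ?thesis .
    qed
    \<comment> \<open>Half of all subsets avoid \<open>e\<close>; summing the additive terms over
      \<open>m\<close> edges thus turns 0.01 into 0.005.\<close>
    have half: "real (card (Pow (E - {e}))) = 2 ^ m / 2" if "e \<in> E" for e
    proof -
      have "m = Suc (card (E - {e}))" unfolding m_def using E that by (rule card.remove)
      then show ?thesis using E by (simp add: card_Pow)
    qed
    have "2 ^ m * (n - 1) = (\<Sum>Z\<in>Pow E. n - 1)" using E by (simp add: card_Pow m_def)
    also have "\<dots> \<le> (\<Sum>Z\<in>Pow E. \<Sum>e\<in>E. P Z e)" by (intro sum_mono total)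
    also have "\<dots> = (\<Sum>e\<in>E. \<Sum>Z\<in>Pow E. P Z e)" by (rule sum.swap)
    also have "\<dots> = (\<Sum>e\<in>E. \<Sum>Z\<in>Pow (E - {e}). P Z e + P (insert e Z) e)"
      using E by (intro sum.cong refl sum_Pow_split) auto
    also have "\<dots> \<le> (\<Sum>e\<in>E. \<Sum>Z\<in>Pow (E - {e}). (1 + exp x) * P Z e + 0.01 * x * exp x / m)"
      using flip by (intro sum_mono) (auto simp: algebra_simps)
    also have "\<dots> = (1 + exp x) * Q + (\<Sum>e\<in>E. real (card (Pow (E - {e}))) * (0.01 * x * exp x / m))"
      by (simp add: Q sum.distrib sum_distrib_left)
    also have "(\<Sum>e\<in>E. real (card (Pow (E - {e}))) * (0.01 * x * exp x / m)) =
        (\<Sum>e\<in>E. 2 ^ m / 2 * (0.01 * x * exp x / m))"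
      by (intro sum.cong refl arg_cong2[where f = "(*)"] half)
    also have "\<dots> = 2 ^ m * (0.005 * x * exp x)" using m by (simp add: m_def)
    finally show ?thesis by simp
  qed
  also have "\<dots> \<le> (1 + exp x) * (2 ^ m * (n * (2 / 21) - 1 + n / (10 * x))) + 2 ^ m * (0.005 * x * exp x)"
    by (intro add_right_mono mult_left_mono Q_le) (simp add: add_nonneg_nonneg)
  also have "\<dots> = 2 ^ m * (n * ((1 + exp x) * (2 / 21 + 1 / (10 * x))) - (1 + exp x) + 0.005 * x * exp x)"
    by (simp add: algebra_simps)
  finally have "n - 1 \<le> n * ((1 + exp x) * (2 / 21 + 1 / (10 * x))) - (1 + exp x) + 0.005 * x * exp x"
    by simp
  \<comment> \<open>Now \<open>n\<close> cancels, and the contradiction comes from the constants: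
    the \<open>- 1\<close> in the component bound was multiplied by \<open>1 + exp x\<close>,
    against only 1 on the left.\<close>
  also have "\<dots> \<le> n * 1 - (1 + exp x) + 0.005 * x * exp x"
    using numeric_bound[OF x] by (intro add_right_mono diff_right_mono mult_left_mono) (auto simp: n_def)
  finally have "exp x \<le> 0.005 * x * exp x" by simp
  then have "1 \<le> 0.005 * x" by simp
  then show False using x by simp
qed

end
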